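(* Let $F$ be an intersecting $4$-partite $4$-uniform hypergraph with parts $V_1,V_2,V_3,V_4$. If $F$ contains four edges whose bases form a matching in $V_1\times V_2$ (that is, four edges $f_1,f_2,f_3,f_4$ such that the sets $f_t\cap(V_1\cup V_2)$, $t=1,2,3,4$, are pairwise disjoint), then $\tau(F)\le 2$.
   Context: A $4$-partite $4$-uniform hypergraph $F$ has a vertex set partitioned into four pairwise disjoint parts $V_1,V_2,V_3,V_4$, and each edge is a set of four vertices containing exactly one vertex of each part. $F$ is intersecting if any two of its edges have a common vertex. The base of an edge $h$ is $h\cap(V_1\cup V_2)$, a pair consisting of one vertex of $V_1$ and one vertex of $V_2$. $\tau(F)$ is the minimum size of a vertex cover of $F$, i.e. of a set of vertices that meets every edge of $F$. *)

theory Defs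
  imports "HOL-Library.Disjoint_Sets" "HOL-Library.Extended_Nat"
begin

text \<open>
  A hypergraph is given by its vertex set and its set of edges, each edge being a set of vertices.
  The parts \<open>V 1, \<dots>, V 4\<close> are a family indexed by \<open>{1..4}\<close>; values of \<open>V\<close> at other indices are
  irrelevant. The vertex set is the union of the parts. Finiteness is not required.
\<close>

definition vertex_set :: "(nat \<Rightarrow> 'a set) \<Rightarrow> 'a set" where
  "vertex_set V = (\<Union>i\<in>{1..4}. V i)"

definition four_partite_hypergraph :: "(nat \<Rightarrow> 'a set) \<Rightarrow> 'a set set \<Rightarrow> bool" where
  "four_partite_hypergraph V F \<longleftrightarrow>
     disjoint_family_on V {1..4} \<and>
     (\<forall>e\<in>F. e \<subseteq> vertex_set V \<and> card e = 4 \<and> (\<forall>i\<in>{1..4}. card (e \<inter> V i) = 1))"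

definition intersecting :: "'a set set \<Rightarrow> bool" where
  "intersecting F \<longleftrightarrow> (\<forall>e\<in>F. \<forall>f\<in>F. e \<inter> f \<noteq> {})"

definition base :: "(nat \<Rightarrow> 'a set) \<Rightarrow> 'a set \<Rightarrow> 'a set" where
  "base V h = h \<inter> (V 1 \<union> V 2)"

definition vertex_cover :: "'a set \<Rightarrow> 'a set set \<Rightarrow> 'a set \<Rightarrow> bool" where
  "vertex_cover X F C \<longleftrightarrow> C \<subseteq> X \<and> (\<forall>e\<in>F. C \<inter> e \<noteq> {})"

text \<open>
  The value lies in \<^typ>\<open>enat\<close> so that it is \<open>\<infinity>\<close>, rather than a junk number, when there is no
  finite cover. Otherwise the infimum is attained, hence a minimum. The finiteness condition is
  needed because \<^const>\<open>card\<close> is \<open>0\<close> on infinite sets.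
\<close>

definition cover_number :: "'a set \<Rightarrow> 'a set set \<Rightarrow> enat" where
  "cover_number X F = (INF C \<in> {C. finite C \<and> vertex_cover X F C}. enat (card C))"

end

theory Submission
  imports Defs
begin

text \<open>
  Edges are read as quadruples of coordinates. The four given edges meet pairwise in the last two
  parts; a union of two equivalence relations is total only if one of them is, so all four share
  one vertex \<open>v\<close>, say in \<open>V 3\<close>. An edge \<open>x\<close> avoiding \<open>v\<close> meets at most one of the four in each of
  \<open>V 1\<close> and \<open>V 2\<close>, so it meets the others in \<open>V 4\<close>. If all edges avoiding \<open>v\<close> agree in \<open>V 4\<close>, then \<open>v\<close>
  and that vertex cover. Two such edges that differ in \<open>V 4\<close> must between them meet each of the four
  in \<open>V 1\<close> or \<open>V 2\<close>, so they have four distinct base vertices and can meet each other only in \<open>V 3\<close>;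
  if there is such a pair, all edges avoiding \<open>v\<close> agree in \<open>V 3\<close>.
\<close>

text \<open>If \<open>c\<close> separates \<open>s\<close>, \<open>t\<close> and \<open>d\<close>
  separates \<open>x\<close>, \<open>y\<close>, then \<open>c x = c y\<close>, and one of
  \<open>s\<close>, \<open>t\<close> has another \<open>c\<close>-value. That element must agree in
  \<open>d\<close> with both \<open>x\<close> and \<open>y\<close>, which is absurd.\<close>

lemma total_union_of_two_kernels:
  assumes "\<And>s t. s \<in> T \<Longrightarrow> t \<in> T \<Longrightarrow> c s = c t \<or> d s = d t"
  shows "(\<forall>s\<in>T. \<forall>t\<in>T. c s = c t) \<or> (\<forall>s\<in>T. \<forall>t\<in>T. d s = d t)"
proof (rule ccontr)
  assume "\<not> ?thesis"
  then obtain s t x y where T: "s \<in> T" "t \<in> T" "x \<in> T" "y \<in> T"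
    and ne: "c s \<noteq> c t" "d x \<noteq> d y"
    by blast
  have d: "d s = d t" and c: "c x = c y"
    using assms T ne by blast+
  obtain z where z: "z \<in> {s, t}" "c z \<noteq> c x"
    using ne(1) by (metis insertI1 insertI2)
  then have "z \<in> T" "c z \<noteq> c y"
    using T c by auto
  then have "d z = d x" "d z = d y"
    using assms T z by blast+
  then show False
    using ne(2) by simp
qed

lemma agree_outside_common_vertex:
  fixes a b c d :: "'e \<Rightarrow> 'a" and f :: "nat \<Rightarrow> 'e"
  assumes meet: "\<And>e g. e \<in> F \<Longrightarrow> g \<in> F \<Longrightarrow> a e = a g \<or> b e = b g \<or> c e = c g \<or> d e = d g"
    and f: "\<And>t. t \<in> {1..4} \<Longrightarrow> f t \<in> F"
    and inj_a: "inj_on (a \<circ> f) {1..4}" and inj_b: "inj_on (b \<circ> f) {1..4}"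
    and star: "\<And>t. t \<in> {1..4} \<Longrightarrow> c (f t) = v"
    and x: "x \<in> F" "c x \<noteq> v" and y: "y \<in> F" "c y \<noteq> v" and "d x \<noteq> d y"
  shows "c x = c y"
proof -
  have at_most_one: "card {t \<in> {1..4::nat}. g (f t) = u} \<le> 1" if "inj_on (g \<circ> f) {1..4}"
    for g :: "'e \<Rightarrow> 'a" and u
    using that by (auto simp: card_le_Suc0_iff_eq inj_on_def)
  have cover: "a z = a (f t) \<or> b z = b (f t) \<or> d z = d (f t)"
    if "z \<in> F" "c z \<noteq> v" "t \<in> {1..4}" for z t
    using meet[OF that(1) f[OF that(3)]] star[OF that(3)] that(2) by auto
  define A where "A u = {t \<in> {1..4::nat}. a (f t) = u}" for u
  define B where "B u = {t \<in> {1..4::nat}. b (f t) = u}" for u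
  have A: "card (A u) \<le> 1" and B: "card (B u) \<le> 1" for u
    unfolding A_def B_def using at_most_one inj_a inj_b by blast+
  \<comment> \<open>As \<open>d x \<noteq> d y\<close>, each \<open>f t\<close> disagrees in
    \<open>d\<close> with \<open>x\<close> or with \<open>y\<close>, and so meets that one in
    \<open>a\<close> or \<open>b\<close>.\<close>
  have "{1..4} \<subseteq> (A (a x) \<union> A (a y)) \<union> (B (b x) \<union> B (b y))"
  proof
    fix t :: nat assume t: "t \<in> {1..4}"
    show "t \<in> (A (a x) \<union> A (a y)) \<union> (B (b x) \<union> B (b y))"
      using cover[OF x t] cover[OF y t] t \<open>d x \<noteq> d y\<close> by (auto simp: A_def B_def)
  qed
  then have "card {1..4::nat} \<le> card ((A (a x) \<union> A (a y)) \<union> (B (b x) \<union> B (b y)))"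
    by (rule card_mono[rotated]) (auto simp: A_def B_def)
  then have four: "4 \<le> card (A (a x) \<union> A (a y)) + card (B (b x) \<union> B (b y))"
    using card_Un_le[of "A (a x) \<union> A (a y)" "B (b x) \<union> B (b y)"] by simp
  have le2: "card (A (a x) \<union> A (a y)) \<le> 2" "card (B (b x) \<union> B (b y)) \<le> 2"
    using card_Un_le[of "A (a x)" "A (a y)"] card_Un_le[of "B (b x)" "B (b y)"]
      A[of "a x"] A[of "a y"] B[of "b x"] B[of "b y"] by linarith+
  \<comment> \<open>Were \<open>a x = a y\<close>, both \<open>A\<close>-sets would coincide and at
    most 1 + 2 indices would be covered; likewise for \<open>b\<close>.\<close>
  have "a x \<noteq> a y"
    using four le2(2) A[of "a x"] by auto
  moreover have "b x \<noteq> b y"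
    using four le2(1) B[of "b x"] by auto
  ultimately show ?thesis
    using meet[OF x(1) y(1)] \<open>d x \<noteq> d y\<close> by blast
qed

text \<open>Coordinates are arbitrary functions so that the last two parts can exchange roles. The
  second cover vertex is a coordinate of an edge \<open>g\<close>, hence lies in the vertex
  set.\<close>

lemma two_coordinates_cover:
  fixes a b c d :: "'e \<Rightarrow> 'a" and f :: "nat \<Rightarrow> 'e"
  assumes "\<And>e g. e \<in> F \<Longrightarrow> g \<in> F \<Longrightarrow> a e = a g \<or> b e = b g \<or> c e = c g \<or> d e = d g"
    and "\<And>t. t \<in> {1..4} \<Longrightarrow> f t \<in> F"
    and "inj_on (a \<circ> f) {1..4}" and "inj_on (b \<circ> f) {1..4}"
    and star: "\<And>t. t \<in> {1..4} \<Longrightarrow> c (f t) = v"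
  shows "\<exists>g\<in>F. (\<forall>e\<in>F. c e = v \<or> c e = c g) \<or> (\<forall>e\<in>F. c e = v \<or> d e = d g)"
proof -
  have agree: "c x = c y" if "x \<in> F" "c x \<noteq> v" "y \<in> F" "c y \<noteq> v" "d x \<noteq> d y" for x y
    using assms that by (rule agree_outside_common_vertex)
  have f1: "f 1 \<in> F" using assms(2) by simp
  show ?thesis
  proof (cases "\<exists>x\<in>F. \<exists>y\<in>F. c x \<noteq> v \<and> c y \<noteq> v \<and> d x \<noteq> d y")
    case True
    then obtain x y where xy: "x \<in> F" "y \<in> F" "c x \<noteq> v" "c y \<noteq> v" "d x \<noteq> d y"
      by blast
    \<comment> \<open>\<open>d e\<close> differs from \<open>d x\<close> or from \<open>d y\<close>,
      so \<open>e\<close> agrees in \<open>c\<close> with one of \<open>x\<close>, \<open>y\<close>,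
      and these agree with each other.\<close>
    have "c e = c x" if e: "e \<in> F" "c e \<noteq> v" for e
    proof (cases "d e = d x")
      case True
      then have "d e \<noteq> d y" using xy(5) by simp
      then have "c e = c y" by (rule agree[OF e xy(2,4)])
      also have "c y = c x" using agree[OF xy(1,3,2,4,5)] by simp
      finally show ?thesis .
    next
      case False
      then show ?thesis by (rule agree[OF e xy(1,3)])
    qed
    then show ?thesis using xy(1) by blast
  next
    case agree_d: False
    show ?thesis
    proof (cases "\<exists>g\<in>F. c g \<noteq> v")
      case True
      then show ?thesis using agree_d by blast
    next
      case False
      \<comment> \<open>Here \<open>v\<close> alone covers; \<open>f 1\<close> only witnesses that
        some \<open>g\<close> exists.\<close>
      then show ?thesis using f1 by blast
    qed
  qed
qed

lemma cover_number_le_2: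
  assumes "u \<in> X" "w \<in> X" "\<And>e. e \<in> F \<Longrightarrow> u \<in> e \<or> w \<in> e"
  shows "cover_number X F \<le> 2"
proof -
  have "{u, w} \<in> {C. finite C \<and> vertex_cover X F C}"
    using assms by (auto simp: vertex_cover_def)
  then have "cover_number X F \<le> enat (card {u, w})"
    unfolding cover_number_def by (rule INF_lower)
  \<comment> \<open>\<open>u\<close> and \<open>w\<close> may coincide, hence only an
    inequality.\<close>
  also have "\<dots> \<le> enat 2"
    using card_insert_le_m1[of 2 "{w}" u] by simp
  finally show ?thesis by (simp add: numeral_eq_enat)
qed

theorem lemma2p2:
  fixes V :: "nat \<Rightarrow> 'a set" and F :: "'a set set"
  assumes "four_partite_hypergraph V F"
    and "intersecting F"
    and "\<exists>f :: nat \<Rightarrow> 'a set. (\<forall>t\<in>{1..4}. f t \<in> F) \<and>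
           disjoint_family_on (\<lambda>t. base V (f t)) {1..4}"
  shows "cover_number (vertex_set V) F \<le> 2"
proof -
  \<comment> \<open>The vertex of \<open>e\<close> in \<open>V i\<close>; \<open>the_elem\<close> is
    meaningful because an edge meets each part in a singleton.\<close>
  define p where "p i e = the_elem (e \<inter> V i)" for i e
  have p: "e \<inter> V i = {p i e}" if "e \<in> F" "i \<in> {1..4}" for e i
  proof -
    have "is_singleton (e \<inter> V i)"
      using assms(1) that unfolding four_partite_hypergraph_def is_singleton_altdef by blast
    then show ?thesis
      unfolding p_def by (simp add: is_singleton_the_elem)
  qed
  have p_in: "p i e \<in> e" "p i e \<in> vertex_set V" if "e \<in> F" "i \<in> {1..4}" for e i
    using p[OF that] that(2) by (auto simp: vertex_set_def)
  have meet: "p 1 e = p 1 g \<or> p 2 e = p 2 g \<or> p 3 e = p 3 g \<or> p 4 e = p 4 g"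
    if e: "e \<in> F" and g: "g \<in> F" for e g
  proof -
    obtain z where z: "z \<in> e" "z \<in> g"
      using assms(2) e g unfolding intersecting_def by blast
    have "e \<subseteq> vertex_set V"
      using assms(1) e unfolding four_partite_hypergraph_def by simp
    then obtain i where i: "i \<in> {1..4}" "z \<in> V i"
      using z(1) unfolding vertex_set_def by (meson UN_E subsetD)
    then have "p i e = p i g"
      using p[OF e i(1)] p[OF g i(1)] z by (metis IntI singletonD)
    moreover have "i = 1 \<or> i = 2 \<or> i = 3 \<or> i = 4"
      using i(1) by auto
    ultimately show ?thesis by blast
  qed
  obtain f where f: "\<And>t. t \<in> {1..4::nat} \<Longrightarrow> f t \<in> F"
    and disj: "disjoint_family_on (\<lambda>t. base V (f t)) {1..4}"
    using assms(3) by blast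
  \<comment> \<open>A repeated coordinate would be a vertex common to two disjoint bases.\<close>
  have inj: "inj_on (p i \<circ> f) {1..4}" if i: "i \<in> {1, 2}" for i
  proof (rule inj_onI, rule ccontr)
    fix s t assume st: "s \<in> {1..4}" "t \<in> {1..4}" "(p i \<circ> f) s = (p i \<circ> f) t" "s \<noteq> t"
    have "p i (f t) \<in> base V (f t)" if "t \<in> {1..4}" for t
      using p[OF f[OF that], of i] i unfolding base_def by auto
    then show False
      using disjoint_family_onD[OF disj st(1,2,4)] st(1-3) by (metis comp_apply disjoint_iff)
  qed
  have "p 3 (f s) = p 3 (f t) \<or> p 4 (f s) = p 4 (f t)" if st: "s \<in> {1..4}" "t \<in> {1..4}" for s t
  proof (cases "s = t")
    case False
    then have "p i (f s) \<noteq> p i (f t)" if "i \<in> {1, 2}" for i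
      using inj_onD[OF inj[OF that] _ st] by auto
    then show ?thesis
      using meet[OF f[OF st(1)] f[OF st(2)]] by blast
  qed simp
  then have "(\<forall>s\<in>{1..4}. \<forall>t\<in>{1..4}. p 3 (f s) = p 3 (f t)) \<or>
      (\<forall>s\<in>{1..4}. \<forall>t\<in>{1..4}. p 4 (f s) = p 4 (f t))"
    by (rule total_union_of_two_kernels)
  \<comment> \<open>\<open>V i\<close> is the part holding the vertex shared by the four edges,
    \<open>V j\<close> the other of the last two.\<close>
  then obtain i j :: nat where ij: "i = 3 \<and> j = 4 \<or> i = 4 \<and> j = 3"
    and "\<forall>s\<in>{1..4}. \<forall>t\<in>{1..4}. p i (f s) = p i (f t)"
    by metis
  then have star: "p i (f t) = p i (f 1)" if "t \<in> {1..4}" for t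
    using that by (meson atLeastAtMost_iff order_refl one_le_numeral)
  have "p 1 e = p 1 g \<or> p 2 e = p 2 g \<or> p i e = p i g \<or> p j e = p j g"
    if "e \<in> F" "g \<in> F" for e g
    using meet[OF that] ij by blast
  \<comment> \<open>The cover is \<open>p i (f 1)\<close> with \<open>p k g\<close>, where
    \<open>k\<close> is \<open>i\<close> or \<open>j\<close> according to the alternative
    obtained.\<close>
  from two_coordinates_cover[OF this f inj inj star]
  obtain g k where g: "g \<in> F" and k: "k \<in> {i, j}"
    and cov: "\<And>e. e \<in> F \<Longrightarrow> p i e = p i (f 1) \<or> p k e = p k g"
    by auto
  have idx: "i \<in> {1..4}" "k \<in> {1..4}"
    using ij k by auto
  show ?thesis
  proof (rule cover_number_le_2)
    show "p i (f 1) \<in> vertex_set V" "p k g \<in> vertex_set V"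
      using p_in(2) f g idx by auto
    show "p i (f 1) \<in> e \<or> p k g \<in> e" if "e \<in> F" for e
      using cov[OF that] p_in(1)[OF that] idx by metis
  qed
qed

end
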